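(* Let $P$ be a poset with inconsistent pairs (PIP) and let $x \in P$. The crossing complex of the hyperplane $H_x$ of $\square_P$ corresponding to $x$ is $$\Delta_{P_x} = \operatorname{link}_{\Delta_P} x,$$ where $P_x := \{\, y \in P : y \text{ is consistent and incomparable with } x\,\}$ is regarded as a sub-PIP of $P$.
   Context: A poset with inconsistent pairs (PIP) is a triple $(P,\le,\nleftrightarrow)$ where $(P,\le)$ is a finite poset and $\nleftrightarrow$ is an irreflexive symmetric relation on $P$ such that $a \nleftrightarrow b$, $a \le a'$, $b \le b'$ imply $a' \nleftrightarrow b'$. Elements $a,b$ with $a\nleftrightarrow b$ are inconsistent; otherwise they are consistent. A subset is consistent if it contains no inconsistent pair. A sub-PIP is a subset with the restricted relations. A downset is a subset closed under going down in $\le$; $\max I$ is the set of maximal elements of $I$. The cubical complex $\square_P$ of a PIP $P$ has as vertices the consistent downsets of $P$, and has a face $C(I,M) := \{\, I \setminus N : N \subseteq M \,\}$ of dimension $|M|$ for each pair $(I,M)$ with $I$ a consistent downset and $M \subseteq \max I$. It is a $\mathrm{CAT}(0)$ cubical complex. The crossing complex $\Delta_P$ of $P$ is the simplicial complex whose vertex set is $P$ and whose faces are the consistent antichains of $P$. The crossing complex of a $\mathrm{CAT}(0)$ cubical complex isomorphic to $\square_{Q}$ is $\Delta_{Q}$ (up to isomorphism this does not depend on the choice of such a PIP $Q$). For a cube $[0,1]^i$, a midplane is a subset in which one coordinate is fixed to be $\tfrac12$. Two midplanes in a cubical complex are adjacent if their intersection is a midplane of another cube; a hyperplane is the union of the midplanes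 in an equivalence class of the transitive closure of adjacency, and the midplanes give it a cubical complex structure. The hyperplanes of $\square_P$ are in bijection with $P$: the hyperplane $H_x$ corresponding to $x$ is the one consisting of the midplanes of the cubes $C(I,M)$ with $x \in M$ separating the vertices containing $x$ from those not containing $x$. As a cubical complex, $H_x$ is isomorphic to $\square_{P_x}$. For a face $\sigma$ of a simplicial complex $\Delta$, $\operatorname{link}_\Delta \sigma := \{\tau \in \Delta : \sigma\cup\tau \in \Delta,\ \sigma\cap\tau = \emptyset\}$; $\operatorname{link}_\Delta x$ means $\operatorname{link}_\Delta\{x\}$. *)

theory Defs
  imports Complex_Main
begin

section \<open>Posets with inconsistent pairs\<close>

record 'a pip =
  elems :: "'a set"
  order :: "'a rel"
  incons :: "'a rel"

definition is_pip :: "'a pip \<Rightarrow> bool" where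
  "is_pip P \<longleftrightarrow>
     finite (elems P) \<and>
     partial_order_on (elems P) (order P) \<and>
     incons P \<subseteq> elems P \<times> elems P \<and> irrefl (incons P) \<and> sym (incons P) \<and>
     (\<forall>a a' b b'. (a, b) \<in> incons P \<longrightarrow> (a, a') \<in> order P \<longrightarrow> (b, b') \<in> order P \<longrightarrow>
        (a', b') \<in> incons P)"

definition sub_pip :: "'a pip \<Rightarrow> 'a set \<Rightarrow> 'a pip" where
  "sub_pip P S =
     \<lparr>elems = S, order = order P \<inter> S \<times> S, incons = incons P \<inter> S \<times> S\<rparr>"

definition consistent :: "'a pip \<Rightarrow> 'a set \<Rightarrow> bool" where
  "consistent P S \<longleftrightarrow> S \<subseteq> elems P \<and> (\<forall>a\<in>S. \<forall>b\<in>S. (a, b) \<notin> incons P)"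

definition downset :: "'a pip \<Rightarrow> 'a set \<Rightarrow> bool" where
  "downset P I \<longleftrightarrow> I \<subseteq> elems P \<and> (\<forall>b\<in>I. \<forall>a. (a, b) \<in> order P \<longrightarrow> a \<in> I)"

definition antichain :: "'a pip \<Rightarrow> 'a set \<Rightarrow> bool" where
  "antichain P A \<longleftrightarrow> A \<subseteq> elems P \<and> (\<forall>a\<in>A. \<forall>b\<in>A. (a, b) \<in> order P \<longrightarrow> a = b)"

definition maximals :: "'a pip \<Rightarrow> 'a set \<Rightarrow> 'a set" where
  "maximals P I = {m \<in> I. \<forall>y\<in>I. (m, y) \<in> order P \<longrightarrow> y = m}"

text \<open>The elements other than \<open>x\<close> that are consistent and incomparable with \<open>x\<close>;
  \<open>x\<close> itself is excluded by reflexivity of the order.\<close>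

definition crossing_elems :: "'a pip \<Rightarrow> 'a \<Rightarrow> 'a set" where
  "crossing_elems P x =
     {y \<in> elems P. (x, y) \<notin> incons P \<and> (x, y) \<notin> order P \<and> (y, x) \<notin> order P}"


section \<open>Cubical complexes\<close>

text \<open>A cubical complex is represented by the set of its nonempty faces, each face being a set
  of points: its vertices (for \<open>cubical_complex\<close>) or all points of its
  geometric realization (for hyperplanes). In both cases the inclusion order on the faces is the
  face relation, and an isomorphism is an isomorphism of face posets.\<close>

definition complex_iso :: "'v set set \<Rightarrow> 'w set set \<Rightarrow> bool" where
  "complex_iso K L \<longleftrightarrow>
     (\<exists>f. bij_betw f K L \<and> (\<forall>C\<in>K. \<forall>D\<in>K. C \<subseteq> D \<longleftrightarrow> f C \<subseteq> f D))"

definition cube_index :: "'a pip \<Rightarrow> ('a set \<times> 'a set) set" where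
  "cube_index P = {(I, M). downset P I \<and> consistent P I \<and> M \<subseteq> maximals P I}"

definition face :: "'a set \<Rightarrow> 'a set \<Rightarrow> 'a set set" where
  "face I M = {I - N | N. N \<subseteq> M}"

definition cubical_complex :: "'a pip \<Rightarrow> 'a set set set" where
  "cubical_complex P = {face I M | I M. (I, M) \<in> cube_index P}"


section \<open>Hyperplanes\<close>

text \<open>Geometric realization: a vertex \<open>J\<close> is placed at its indicator function in the space of
  real functions on the elements, and \<open>C(I,M)\<close> becomes the cube spanned by its vertices
  \<open>I - N\<close>, i.e. \<open>[0,1]\<^sup>M\<close> with all coordinates outside \<open>M\<close> constantly 1 (on \<open>I - M\<close>) or 0
  (off \<open>I\<close>). Distinct cubes meet in common faces, so intersections in this
  space are the intersections in the complex.\<close>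

definition solid_cube :: "'a set \<Rightarrow> 'a set \<Rightarrow> ('a \<Rightarrow> real) set" where
  "solid_cube I M =
     {p. (\<forall>y\<in>M. 0 \<le> p y \<and> p y \<le> 1) \<and> (\<forall>y\<in>I - M. p y = 1) \<and> (\<forall>y. y \<notin> I \<longrightarrow> p y = 0)}"

text \<open>For \<open>x \<in> M\<close>: the midplane of \<open>C(I,M)\<close> separating its vertices that contain \<open>x\<close>
  (coordinate 1) from those that do not (coordinate 0).\<close>

definition midplane :: "'a set \<Rightarrow> 'a set \<Rightarrow> 'a \<Rightarrow> ('a \<Rightarrow> real) set" where
  "midplane I M x = {p \<in> solid_cube I M. p x = 1/2}"

definition midplanes :: "'a pip \<Rightarrow> ('a \<Rightarrow> real) set set" where
  "midplanes P = {midplane I M x | I M x. (I, M) \<in> cube_index P \<and> x \<in> M}"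

text \<open>The intersection may be a midplane of any cube of the complex, possibly one of the given
  two: the midplane of a cube is adjacent to the midplanes of its faces that it contains. In
  particular adjacency is reflexive, so that its transitive closure is an equivalence relation.\<close>

definition adjacent :: "'a pip \<Rightarrow> ('a \<Rightarrow> real) set rel" where
  "adjacent P = {(m, m'). m \<in> midplanes P \<and> m' \<in> midplanes P \<and> m \<inter> m' \<in> midplanes P}"

text \<open>A hyperplane is given by its cubical complex structure, i.e. by an equivalence class of
  midplanes; the underlying point set is the union of the class.\<close>

definition hyperplanes :: "'a pip \<Rightarrow> ('a \<Rightarrow> real) set set set" where
  "hyperplanes P = midplanes P // (adjacent P)\<^sup>+"

definition hyperplane :: "'a pip \<Rightarrow> 'a \<Rightarrow> ('a \<Rightarrow> real) set set" where
  "hyperplane P x = {midplane I M x | I M. (I, M) \<in> cube_index P \<and> x \<in> M}"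


section \<open>Crossing complexes\<close>

text \<open>Simplicial complexes are sets of faces (including the empty face); every vertex is a face,
  so the vertex set of \<open>\<Delta>\<close> is \<open>\<Union>\<Delta>\<close>.\<close>

definition simplicial_iso :: "'v set set \<Rightarrow> 'w set set \<Rightarrow> bool" where
  "simplicial_iso \<Delta> \<Gamma> \<longleftrightarrow> (\<exists>f. bij_betw f (\<Union>\<Delta>) (\<Union>\<Gamma>) \<and> (image f) ` \<Delta> = \<Gamma>)"

definition link :: "'v set set \<Rightarrow> 'v set \<Rightarrow> 'v set set" where
  "link \<Delta> \<sigma> = {\<tau> \<in> \<Delta>. \<sigma> \<union> \<tau> \<in> \<Delta> \<and> \<sigma> \<inter> \<tau> = {}}"

definition crossing_complex :: "'a pip \<Rightarrow> 'a set set" where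
  "crossing_complex P = {A. consistent P A \<and> antichain P A}"

text \<open>\<open>\<Delta>\<close> is, up to isomorphism, the crossing complex of the cubical complex \<open>K\<close>: \<open>K\<close> is isomorphic
  to the cubical complex of some PIP, and \<open>\<Delta>\<close> is isomorphic to the crossing complex of every
  such PIP. Since PIPs are finite, it suffices to consider those with elements in \<open>nat\<close>.\<close>

definition is_crossing_complex_of :: "'v set set \<Rightarrow> 'w set set \<Rightarrow> bool" where
  "is_crossing_complex_of \<Delta> K \<longleftrightarrow>
     (\<exists>Q :: nat pip. is_pip Q \<and> complex_iso K (cubical_complex Q)) \<and>
     (\<forall>Q :: nat pip. is_pip Q \<longrightarrow> complex_iso K (cubical_complex Q) \<longrightarrow>
        simplicial_iso (crossing_complex Q) \<Delta>)"

end

theory Submission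
  imports Defs
begin

text \<open>The cells of the hyperplane of \<open>x\<close> come from the cubes \<open>(I, M)\<close> with \<open>x \<in> M\<close>. For these,
  \<open>I\<close> is the union of \<open>I \<inter> P\<^sub>x\<close> and the principal downset of \<open>x\<close>, so
  \<open>(I, M) \<mapsto> (I \<inter> P\<^sub>x, M - {x})\<close> identifies them with the cubes of \<open>P\<^sub>x\<close>. The crossing complex
  depends only on the cubical complex: the elements of a PIP are the classes of edges under the
  relation of being opposite in a square, and the consistent antichains are the sets of directions
  of the cubes.\<close>

section \<open>Cubes of a PIP\<close>

text \<open>An isomorphism of face posets need not fix the vertex given by the empty downset, so it
  determines neither the order nor the inconsistent pairs: a two-element chain and a pair of
  inconsistent elements both give a path with two edges. What survives is the information which
  directions span a common cube, and the crossing complex records nothing more.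

  One element accounts for exactly one class of edges because every edge of direction
  \<open>x\<close> can be moved through squares to the edge below the principal downset of
  \<open>x\<close>.

  The identification of cubes is inverted by adding the principal downset of \<open>x\<close> to the
  top vertex and \<open>x\<close> to the directions. This stays consistent because inconsistency is
  inherited upwards: a conflict with something below \<open>x\<close> would be a conflict with
  \<open>x\<close> itself.\<close>

lemma face_eq: "M \<subseteq> I \<Longrightarrow> face I M = {J. I - M \<subseteq> J \<and> J \<subseteq> I}"
proof (intro equalityI subsetI)
  fix J assume "M \<subseteq> I" "J \<in> {J. I - M \<subseteq> J \<and> J \<subseteq> I}"
  then have "J = I - (I - J)" "I - J \<subseteq> M" by auto
  then show "J \<in> face I M" unfolding face_def by blast
qed (auto simp: face_def)

text \<open>A cube is an interval in the subset order, so inclusion only compares the largest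
  vertices \<open>I\<close>, \<open>I'\<close> and the smallest vertices \<open>I - M\<close>,
  \<open>I' - M'\<close>.\<close>

lemma face_subset_iff:
  assumes "M \<subseteq> I" "M' \<subseteq> I'"
  shows "face I M \<subseteq> face I' M' \<longleftrightarrow> I \<subseteq> I' \<and> I' - M' \<subseteq> I - M"
proof
  assume "face I M \<subseteq> face I' M'"
  moreover have "I \<in> face I M" "I - M \<in> face I M" using assms by (auto simp: face_eq)
  ultimately have "I \<in> face I' M'" "I - M \<in> face I' M'" by blast+
  then show "I \<subseteq> I' \<and> I' - M' \<subseteq> I - M" using assms by (auto simp: face_eq)
next
  assume "I \<subseteq> I' \<and> I' - M' \<subseteq> I - M"
  then show "face I M \<subseteq> face I' M'" using assms by (auto simp: face_eq)
qed

text \<open>The criterion is the one for the cubes themselves. Midplanes of a fixed direction can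
  therefore be compared with cubes of another PIP through their index pairs alone.\<close>

lemma midplane_subset_iff:
  assumes "M \<subseteq> I" "M' \<subseteq> I'" "x \<in> M" "x \<in> M'"
  shows "midplane I M x \<subseteq> midplane I' M' x \<longleftrightarrow> I \<subseteq> I' \<and> I' - M' \<subseteq> I - M"
proof
  assume sub: "midplane I M x \<subseteq> midplane I' M' x"
  \<comment> \<open>These are the midpoints of the edges of direction \<open>x\<close> at the
    largest and at the smallest vertex of the cube. Vanishing of \<open>p\<close> off
    \<open>I'\<close> bounds the top vertex, and \<open>q\<close> being 1 on \<open>I' - M'\<close>
    bounds the bottom vertex.\<close>
  define p q :: "'a \<Rightarrow> real"
    where "p y = (if y = x then 1/2 else if y \<in> I then 1 else 0)"
      and "q y = (if y = x then 1/2 else if y \<in> I - M then 1 else 0)" for y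
  have "p \<in> midplane I M x" "q \<in> midplane I M x"
    using assms by (auto simp: midplane_def solid_cube_def p_def q_def)
  with sub have p: "\<And>y. y \<notin> I' \<Longrightarrow> p y = 0" and q: "\<And>y. y \<in> I' - M' \<Longrightarrow> q y = 1"
    by (auto simp: midplane_def solid_cube_def)
  have "y \<in> I'" if "y \<in> I" for y
    using p[of y] that by (cases "y \<in> I'") (auto simp: p_def split: if_splits)
  moreover have "y \<in> I - M" if "y \<in> I' - M'" for y
    using q[OF that] by (auto simp: q_def split: if_splits)
  ultimately show "I \<subseteq> I' \<and> I' - M' \<subseteq> I - M" by blast
next
  assume le: "I \<subseteq> I' \<and> I' - M' \<subseteq> I - M"
  show "midplane I M x \<subseteq> midplane I' M' x"
  proof
    fix p assume p: "p \<in> midplane I M x"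
    \<comment> \<open>A coordinate in \<open>M'\<close> may lie outside \<open>M\<close>, where
      \<open>p\<close> is constantly 0 or 1, so the bounds are established for every
      coordinate.\<close>
    have "0 \<le> p y \<and> p y \<le> 1" for y
      using p by (cases "y \<in> M"; cases "y \<in> I") (auto simp: midplane_def solid_cube_def)
    then show "p \<in> midplane I' M' x"
      using p le by (auto simp: midplane_def solid_cube_def)
  qed
qed

lemma cube_index_subset: "(I, M) \<in> cube_index P \<Longrightarrow> M \<subseteq> I"
  by (auto simp: cube_index_def maximals_def)

lemma cube_index_elems: "(I, M) \<in> cube_index P \<Longrightarrow> I \<subseteq> elems P"
  by (auto simp: cube_index_def downset_def)

lemma finite_cube_directions: "is_pip P \<Longrightarrow> (I, M) \<in> cube_index P \<Longrightarrow> finite M"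
  using cube_index_subset cube_index_elems unfolding is_pip_def by (metis finite_subset)

text \<open>The faces of a cube: coordinates in \<open>N\<close> are fixed to 0, those in
  \<open>L\<close> stay free, and the rest of \<open>M\<close> is fixed to 1.\<close>

lemma cube_index_subface:
  assumes "(I, M) \<in> cube_index P" "N \<subseteq> M" "L \<subseteq> M" "N \<inter> L = {}"
  shows "(I - N, L) \<in> cube_index P"
  using assms unfolding cube_index_def downset_def consistent_def maximals_def by blast

lemma face_in_complex: "(I, M) \<in> cube_index P \<Longrightarrow> face I M \<in> cubical_complex P"
  by (auto simp: cubical_complex_def)

lemma cubical_complex_eq: "cubical_complex P = (\<lambda>(I, M). face I M) ` cube_index P"
  by (auto simp: cubical_complex_def)

section \<open>Laws of PIPs, cubes spanned by antichains, and moving edges\<close>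

lemma pip_order:
  assumes "is_pip P"
  shows "x \<in> elems P \<Longrightarrow> (x, x) \<in> order P"
    and "(x, y) \<in> order P \<Longrightarrow> (y, z) \<in> order P \<Longrightarrow> (x, z) \<in> order P"
    and "(x, y) \<in> order P \<Longrightarrow> (y, x) \<in> order P \<Longrightarrow> x = y"
    and "(x, y) \<in> order P \<Longrightarrow> x \<in> elems P \<and> y \<in> elems P"
proof -
  have "order P \<subseteq> elems P \<times> elems P" "\<forall>x\<in>elems P. (x, x) \<in> order P" "trans (order P)"
    "antisym (order P)"
    using assms by (auto simp: is_pip_def partial_order_on_def preorder_on_def refl_on_def)
  then show "x \<in> elems P \<Longrightarrow> (x, x) \<in> order P"
    and "(x, y) \<in> order P \<Longrightarrow> (y, z) \<in> order P \<Longrightarrow> (x, z) \<in> order P"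
    and "(x, y) \<in> order P \<Longrightarrow> (y, x) \<in> order P \<Longrightarrow> x = y"
    and "(x, y) \<in> order P \<Longrightarrow> x \<in> elems P \<and> y \<in> elems P"
    by (blast, meson transD, meson antisymD, blast)
qed

lemma pip_incons:
  assumes "is_pip P"
  shows "(x, x) \<notin> incons P"
    and "(x, y) \<in> incons P \<Longrightarrow> (y, x) \<in> incons P"
    and "(x, y) \<in> incons P \<Longrightarrow> (x, x') \<in> order P \<Longrightarrow> (y, y') \<in> order P \<Longrightarrow> (x', y') \<in> incons P"
    and "(x, y) \<in> incons P \<Longrightarrow> x \<in> elems P \<and> y \<in> elems P"
  using assms unfolding is_pip_def irrefl_def sym_def by blast+

text \<open>An inconsistent pair below \<open>A\<close> would propagate up to one in
  \<open>A\<close>, and the antichain condition makes \<open>A\<close> maximal in its down-closure.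
  For \<open>A = {x}\<close> this is the reference edge of direction \<open>x\<close>.\<close>

lemma cube_index_down_closure:
  assumes P: "is_pip P" and A: "A \<in> crossing_complex P"
  shows "((order P)\<inverse> `` A, A) \<in> cube_index P"
proof -
  have A': "A \<subseteq> elems P" "\<And>a b. a \<in> A \<Longrightarrow> b \<in> A \<Longrightarrow> (a, b) \<notin> incons P"
    "\<And>a b. a \<in> A \<Longrightarrow> b \<in> A \<Longrightarrow> (a, b) \<in> order P \<Longrightarrow> a = b"
    using A unfolding crossing_complex_def consistent_def antichain_def by blast+
  let ?I = "(order P)\<inverse> `` A"
  have I_iff: "y \<in> ?I \<longleftrightarrow> (\<exists>a\<in>A. (y, a) \<in> order P)" for y by blast
  have sub: "?I \<subseteq> elems P" using pip_order(4)[OF P] by blast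
  have "y \<in> ?I" if "z \<in> ?I" "(y, z) \<in> order P" for y z
  proof -
    obtain a where "a \<in> A" "(z, a) \<in> order P" using \<open>z \<in> ?I\<close> by blast
    then show ?thesis using pip_order(2)[OF P that(2)] by blast
  qed
  with sub have "downset P ?I" unfolding downset_def by blast
  moreover have "(y, z) \<notin> incons P" if yz: "y \<in> ?I" "z \<in> ?I" for y z
  proof
    assume "(y, z) \<in> incons P"
    moreover obtain a b where "a \<in> A" "(y, a) \<in> order P" "b \<in> A" "(z, b) \<in> order P"
      using yz by blast
    ultimately show False using A'(2) pip_incons(3)[OF P] by blast
  qed
  with sub have "consistent P ?I" unfolding consistent_def by blast
  moreover have "A \<subseteq> maximals P ?I"
  proof
    fix a assume a: "a \<in> A"
    have "y = a" if "b \<in> A" "(y, b) \<in> order P" "(a, y) \<in> order P" for y b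
      using that a A'(3)[of a b] pip_order(2)[OF P, of a y b] pip_order(3)[OF P, of y a] by simp
    moreover have "a \<in> ?I" using a A'(1) pip_order(1)[OF P] by auto
    ultimately show "a \<in> maximals P ?I"
      unfolding maximals_def I_iff by blast
  qed
  ultimately show ?thesis by (simp add: cube_index_def)
qed

lemma crossing_complex_eq:
  assumes "is_pip P"
  shows "crossing_complex P = snd ` cube_index P"
proof (intro equalityI subsetI)
  fix A assume "A \<in> crossing_complex P"
  from cube_index_down_closure[OF assms this] show "A \<in> snd ` cube_index P" by force
next
  fix A assume "A \<in> snd ` cube_index P"
  then obtain I where I: "I \<subseteq> elems P" "consistent P I" "A \<subseteq> maximals P I"
    by (auto simp: cube_index_def downset_def)
  then have "A \<subseteq> I" by (auto simp: maximals_def)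
  then have "consistent P A" using I(2) by (auto simp: consistent_def)
  moreover have "antichain P A"
    using I \<open>A \<subseteq> I\<close> unfolding antichain_def maximals_def by blast
  ultimately show "A \<in> crossing_complex P" by (simp add: crossing_complex_def)
qed

lemma singleton_in_crossing_complex:
  "is_pip P \<Longrightarrow> x \<in> elems P \<Longrightarrow> {x} \<in> crossing_complex P"
  by (auto simp: crossing_complex_def consistent_def antichain_def pip_incons(1))

lemma Union_crossing_complex: "is_pip P \<Longrightarrow> \<Union> (crossing_complex P) = elems P"
  using singleton_in_crossing_complex[of P]
  by (auto simp: crossing_complex_def consistent_def)

text \<open>If \<open>I\<close> is not the principal downset of its maximal element \<open>x\<close>, it has another maximal
  element \<open>y\<close>, and the edge \<open>(I, {x})\<close> is opposite to \<open>(I - {y}, {x})\<close> in the square \<open>(I, {x, y})\<close>.\<close>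

lemma edge_induct [consumes 2, case_names base step]:
  assumes P: "is_pip P" and "(I, {x}) \<in> cube_index P"
    and base: "S ((order P)\<inverse> `` {x})"
    and step: "\<And>J y. (J, {x, y}) \<in> cube_index P \<Longrightarrow> x \<noteq> y \<Longrightarrow> S (J - {y}) \<Longrightarrow> S J"
  shows "S I"
  using assms(2)
proof (induction "card I" arbitrary: I rule: less_induct)
  case less
  have down: "downset P I" "consistent P I" and x: "x \<in> maximals P I"
    using less.prems by (auto simp: cube_index_def)
  have IE: "I \<subseteq> elems P" using down by (auto simp: downset_def)
  have fin: "finite I" using IE P finite_subset by (auto simp: is_pip_def)
  show ?case
  proof (cases "I \<subseteq> (order P)\<inverse> `` {x}")
    case True
    moreover have "(order P)\<inverse> `` {x} \<subseteq> I"
      using down x by (auto simp: downset_def maximals_def)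
    ultimately show ?thesis using base by (simp add: subset_antisym)
  next
    case False
    then obtain z where z: "z \<in> I" "(z, x) \<notin> order P" by blast
    \<comment> \<open>\<open>Z\<close> is closed upwards in \<open>I\<close>, so a maximal element
      \<open>y\<close> of \<open>Z\<close> is maximal in \<open>I\<close>. It differs from
      \<open>x\<close> because \<open>z\<close> lies below \<open>y\<close> but not below
      \<open>x\<close>.\<close>
    define Z where "Z = {y \<in> I. (z, y) \<in> order P}"
    let ?R = "\<lambda>a b. (a, b) \<in> order P \<and> a \<noteq> b"
    have zZ: "z \<in> Z" using z IE pip_order(1)[OF P] by (auto simp: Z_def)
    have tr: "transp_on Z ?R"
    proof (rule transp_onI)
      fix a b c
      assume "?R a b" "?R b c"
      then show "?R a c" using pip_order(2)[OF P, of a b c] pip_order(3)[OF P, of a b] by auto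
    qed
    have as: "asymp_on Z ?R" using pip_order(3)[OF P] by (auto simp: asymp_on_def)
    have "finite Z" "Z \<noteq> {}" using fin zZ by (auto simp: Z_def)
    from Finite_Set.bex_max_element[OF this(1) as tr this(2)]
    obtain y where y: "y \<in> Z" "\<And>b. b \<in> Z \<Longrightarrow> (y, b) \<in> order P \<Longrightarrow> b = y" by blast
    have ymax: "y \<in> maximals P I"
    proof -
      have yZ: "y \<in> I" "(z, y) \<in> order P" using y(1) by (auto simp: Z_def)
      have "b = y" if "b \<in> I" "(y, b) \<in> order P" for b
        using y(2)[of b] that pip_order(2)[OF P yZ(2) that(2)] by (auto simp: Z_def)
      with yZ show ?thesis by (auto simp: maximals_def)
    qed
    have "x \<noteq> y" using y(1) z by (auto simp: Z_def)
    have sq: "(I, {x, y}) \<in> cube_index P"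
      using down x ymax by (simp add: cube_index_def)
    have "card (I - {y}) < card I"
      using fin ymax by (intro psubset_card_mono) (auto simp: maximals_def)
    moreover have "(I - {y}, {x}) \<in> cube_index P"
      using cube_index_subface[OF sq, of "{y}" "{x}"] \<open>x \<noteq> y\<close> by auto
    ultimately show ?thesis using less.hyps step[OF sq \<open>x \<noteq> y\<close>] by blast
  qed
qed

lemma is_pip_sub_pip:
  assumes "is_pip P" "S \<subseteq> elems P"
  shows "is_pip (sub_pip P S)"
proof -
  have "finite S" using assms finite_subset by (auto simp: is_pip_def)
  moreover have "refl_on S (order P \<inter> S \<times> S)"
    using pip_order(1)[OF assms(1)] assms(2) by (auto simp: refl_on_def)
  moreover have "trans (order P \<inter> S \<times> S)"
    using pip_order(2)[OF assms(1)] unfolding trans_def by blast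
  moreover have "antisym (order P \<inter> S \<times> S)"
    using pip_order(3)[OF assms(1)] unfolding antisym_def by blast
  moreover have "sym (incons P \<inter> S \<times> S)" "irrefl (incons P \<inter> S \<times> S)"
    using pip_incons(1,2)[OF assms(1)] unfolding sym_def irrefl_def by blast+
  moreover have "\<forall>a a' b b'. (a, b) \<in> incons P \<inter> S \<times> S \<longrightarrow> (a, a') \<in> order P \<inter> S \<times> S \<longrightarrow>
      (b, b') \<in> order P \<inter> S \<times> S \<longrightarrow> (a', b') \<in> incons P \<inter> S \<times> S"
    using pip_incons(3)[OF assms(1)] by blast
  ultimately show ?thesis
    by (simp add: is_pip_def sub_pip_def partial_order_on_def preorder_on_def)
qed


section \<open>Hyperplanes\<close>

text \<open>Recovers the direction of a midplane from its points: the midpoint of the edge at the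
  top vertex has value 0 or 1 in every coordinate except \<open>x\<close>.\<close>

lemma midplane_constant_half:
  assumes "x \<in> M" "M \<subseteq> I"
  shows "(\<forall>p\<in>midplane I M x. p z = 1/2) \<longleftrightarrow> z = x"
proof
  have "(\<lambda>y. if y = x then 1/2 else if y \<in> I then 1 else 0) \<in> midplane I M x"
    using assms by (auto simp: midplane_def solid_cube_def)
  moreover assume "\<forall>p\<in>midplane I M x. p z = 1/2"
  ultimately show "z = x" by (fastforce split: if_splits)
qed (simp add: midplane_def)

text \<open>The intersection of adjacent midplanes is again a midplane, of some direction
  \<open>z\<close>. The directions of both midplanes are constantly 1/2 on it, so both equal
  \<open>z\<close>.\<close>

lemma adjacent_hyperplane:
  assumes "(m, m') \<in> adjacent P" "m \<in> hyperplane P x"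
  shows "m' \<in> hyperplane P x"
proof -
  obtain I M where m: "m = midplane I M x" "(I, M) \<in> cube_index P" "x \<in> M"
    using assms(2) by (auto simp: hyperplane_def)
  obtain I' M' y where m': "m' = midplane I' M' y" "(I', M') \<in> cube_index P" "y \<in> M'"
    using assms(1) by (auto simp: adjacent_def midplanes_def)
  obtain J N z where "m \<inter> m' = midplane J N z" "(J, N) \<in> cube_index P" "z \<in> N"
    using assms(1) by (auto simp: adjacent_def midplanes_def)
  then have half: "w = z" if "\<forall>p\<in>m \<inter> m'. p w = 1/2" for w
    using that midplane_constant_half[of z N J w] cube_index_subset by metis
  have "x = z" "y = z" by (rule half, simp add: m(1) m'(1) midplane_def)+
  then show ?thesis using m' by (auto simp: hyperplane_def)
qed

lemma subset_imp_adjacent: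
  assumes "m \<in> midplanes P" "m' \<in> midplanes P" "m \<subseteq> m'"
  shows "(m, m') \<in> adjacent P" "(m', m) \<in> adjacent P"
  using assms by (auto simp: adjacent_def Int_absorb1 Int_absorb2)

lemma hyperplane_in_hyperplanes:
  assumes P: "is_pip P" and x: "x \<in> elems P"
  shows "hyperplane P x \<in> hyperplanes P"
proof -
  \<comment> \<open>The midplane of an edge is a single point. The one on the edge below the
    principal downset of \<open>x\<close> serves as representative of the class.\<close>
  define e where "e I = midplane I {x} x" for I
  define I0 where "I0 = (order P)\<inverse> `` {x}"
  have I0: "(I0, {x}) \<in> cube_index P"
    unfolding I0_def
    by (rule cube_index_down_closure[OF P singleton_in_crossing_complex[OF P x]])
  have mp: "midplane I M x \<in> midplanes P" if "(I, M) \<in> cube_index P" "x \<in> M" for I M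
    using that by (auto simp: midplanes_def)
  have edge: "(e I0, e I) \<in> (adjacent P)\<^sup>+" if "(I, {x}) \<in> cube_index P" for I
    using P that
  proof (induction rule: edge_induct)
    case base
    show ?case
      using subset_imp_adjacent(1)[of "e I0" P "e I0"] mp[OF I0] by (auto simp: e_def I0_def)
  next
    case (step J y)
    have ci: "(J - {y}, {x}) \<in> cube_index P" "(J, {x}) \<in> cube_index P"
      using cube_index_subface[OF step(1), of "{y}" "{x}"]
        cube_index_subface[OF step(1), of "{}" "{x}"] step(2) by auto
    note sub = cube_index_subset[OF step(1)]
    \<comment> \<open>The midplane of the square \<open>(J, {x, y})\<close> contains the midpoints
      of both its edges of direction \<open>x\<close>, so two adjacencies lead from one edge to the
      opposite one.\<close>
    have "e (J - {y}) \<subseteq> midplane J {x, y} x"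
      unfolding e_def by (subst midplane_subset_iff) (use sub step(2) in auto)
    then have "(e (J - {y}), midplane J {x, y} x) \<in> adjacent P"
      by (intro subset_imp_adjacent) (auto simp: e_def intro: mp ci step(1))
    moreover have "e J \<subseteq> midplane J {x, y} x"
      unfolding e_def by (subst midplane_subset_iff) (use sub in auto)
    then have "(midplane J {x, y} x, e J) \<in> adjacent P"
      by (intro subset_imp_adjacent) (auto simp: e_def intro: mp ci step(1))
    ultimately show ?case using step(3) by (meson trancl.trancl_into_trancl)
  qed
  have "(e I0, midplane I M x) \<in> (adjacent P)\<^sup>+" if IM: "(I, M) \<in> cube_index P" "x \<in> M" for I M
  proof -
    have ci: "(I, {x}) \<in> cube_index P" using cube_index_subface[OF IM(1), of "{}" "{x}"] IM by auto
    have "e I \<subseteq> midplane I M x"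
      unfolding e_def by (subst midplane_subset_iff) (use cube_index_subset[OF IM(1)] IM(2) in auto)
    then have "(e I, midplane I M x) \<in> adjacent P"
      by (intro subset_imp_adjacent) (auto simp: e_def intro: mp ci IM)
    then show ?thesis using edge[OF ci] by (meson trancl.trancl_into_trancl)
  qed
  then have "hyperplane P x \<subseteq> (adjacent P)\<^sup>+ `` {e I0}" by (auto simp: hyperplane_def)
  moreover have "m \<in> hyperplane P x" if "(e I0, m) \<in> (adjacent P)\<^sup>+" for m
    using that
  proof induction
    case (base m)
    then show ?case using adjacent_hyperplane I0 by (fastforce simp: hyperplane_def e_def)
  next
    case (step m m')
    then show ?case using adjacent_hyperplane by fast
  qed
  ultimately have "hyperplane P x = (adjacent P)\<^sup>+ `` {e I0}" by blast
  moreover have "e I0 \<in> midplanes P" using mp[OF I0] by (simp add: e_def)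
  ultimately show ?thesis unfolding hyperplanes_def quotient_def by blast
qed


section \<open>Isomorphisms\<close>

text \<open>Equality of sets is inclusion both ways, so matching inclusions already make the
  assignment of \<open>\<psi> c\<close> to \<open>\<phi> c\<close> well defined and
  injective.\<close>

lemma complex_isoI:
  assumes "\<And>c d. c \<in> X \<Longrightarrow> d \<in> X \<Longrightarrow> \<phi> c \<subseteq> \<phi> d \<longleftrightarrow> \<psi> c \<subseteq> \<psi> d"
  shows "complex_iso (\<phi> ` X) (\<psi> ` X)"
proof -
  define f where "f C = \<psi> (inv_into X \<phi> C)" for C
  have f: "f (\<phi> c) = \<psi> c" if "c \<in> X" for c
  proof -
    have c': "inv_into X \<phi> (\<phi> c) \<in> X" "\<phi> (inv_into X \<phi> (\<phi> c)) = \<phi> c"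
      using that by (simp_all add: inv_into_into f_inv_into_f)
    then show ?thesis
      using assms[OF c'(1) that] assms[OF that c'(1)] by (simp add: f_def subset_antisym)
  qed
  have le: "\<forall>C\<in>\<phi> ` X. \<forall>D\<in>\<phi> ` X. C \<subseteq> D \<longleftrightarrow> f C \<subseteq> f D" using assms f by auto
  moreover have "bij_betw f (\<phi> ` X) (\<psi> ` X)"
    unfolding bij_betw_def
  proof
    show "inj_on f (\<phi> ` X)" using le by (intro inj_onI subset_antisym) auto
    show "f ` \<phi> ` X = \<psi> ` X" using f by (force simp: image_image)
  qed
  ultimately show ?thesis unfolding complex_iso_def by blast
qed

lemma complex_iso_sym: "complex_iso K L \<Longrightarrow> complex_iso L K"
proof -
  assume "complex_iso K L"
  then obtain f where f: "bij_betw f K L" "\<forall>C\<in>K. \<forall>D\<in>K. C \<subseteq> D \<longleftrightarrow> f C \<subseteq> f D"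
    unfolding complex_iso_def by blast
  have "bij_betw (inv_into K f) L K" using f(1) by (rule bij_betw_inv_into)
  moreover have "inv_into K f C \<in> K \<and> f (inv_into K f C) = C" if "C \<in> L" for C
    using that f(1) by (auto simp: bij_betw_def f_inv_into_f inv_into_into)
  then have "\<forall>C\<in>L. \<forall>D\<in>L. C \<subseteq> D \<longleftrightarrow> inv_into K f C \<subseteq> inv_into K f D" using f(2) by metis
  ultimately show ?thesis unfolding complex_iso_def by blast
qed

lemma complex_iso_trans:
  assumes "complex_iso K L" "complex_iso L M"
  shows "complex_iso K M"
proof -
  obtain f g where f: "bij_betw f K L" "\<forall>C\<in>K. \<forall>D\<in>K. C \<subseteq> D \<longleftrightarrow> f C \<subseteq> f D"
    and g: "bij_betw g L M" "\<forall>C\<in>L. \<forall>D\<in>L. C \<subseteq> D \<longleftrightarrow> g C \<subseteq> g D"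
    using assms unfolding complex_iso_def by blast
  have "\<forall>C\<in>K. \<forall>D\<in>K. C \<subseteq> D \<longleftrightarrow> (g \<circ> f) C \<subseteq> (g \<circ> f) D"
    using f(2) g(2) bij_betw_apply[OF f(1)] by (metis comp_apply)
  then show ?thesis using bij_betw_trans[OF f(1) g(1)] unfolding complex_iso_def by blast
qed

text \<open>When a complex contains the singletons of all its vertices, these are its minimal faces, so
  an isomorphism of face posets is induced by a bijection of the vertices.\<close>

lemma complex_iso_imp_simplicial_iso:
  assumes iso: "complex_iso K L"
    and K: "{} \<notin> K" "\<And>v. v \<in> \<Union>K \<Longrightarrow> {v} \<in> K"
    and L: "{} \<notin> L" "\<And>v. v \<in> \<Union>L \<Longrightarrow> {v} \<in> L"
  shows "simplicial_iso K L"
proof -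
  obtain f where bij: "bij_betw f K L" and f: "\<forall>C\<in>K. \<forall>D\<in>K. C \<subseteq> D \<longleftrightarrow> f C \<subseteq> f D"
    using iso unfolding complex_iso_def by blast
  have le: "C \<subseteq> D \<longleftrightarrow> f C \<subseteq> f D" if "C \<in> K" "D \<in> K" for C D
    by (rule f[rule_format, OF that])
  have fL: "f C \<in> L" if "C \<in> K" for C using bij that by (rule bij_betw_apply)
  have surj: "\<exists>C\<in>K. D = f C" if "D \<in> L" for D
    using bij_betw_imp_surj_on[OF bij] that by blast
  have "\<exists>w. f {v} = {w}" if v: "v \<in> \<Union>K" for v
  proof -
    have fv: "f {v} \<in> L" using fL K(2)[OF v] .
    then have "f {v} \<noteq> {}" using L(1) by auto
    then obtain w where w: "w \<in> f {v}" by auto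
    then have "w \<in> \<Union>L" using fv by (rule UnionI[rotated])
    then obtain C where C: "C \<in> K" "{w} = f C" using surj[OF L(2)] by auto
    have "f C \<subseteq> f {v}" using w unfolding C(2)[symmetric] by simp
    then have "C \<subseteq> {v}" unfolding le[OF C(1) K(2)[OF v]] .
    moreover have "C \<noteq> {}" using C(1) K(1) by auto
    ultimately have "C = {v}" by auto
    with C(2) show ?thesis by auto
  qed
  then obtain g where g: "\<And>v. v \<in> \<Union>K \<Longrightarrow> f {v} = {g v}" by metis
  \<comment> \<open>A vertex \<open>v\<close> lies in \<open>C\<close> iff \<open>{v}\<close> is a
    face of \<open>C\<close>, and this is a statement about inclusion of faces, which
    \<open>f\<close> preserves and reflects.\<close>
  have img: "f C = g ` C" if C: "C \<in> K" for C
  proof (intro equalityI subsetI)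
    fix w assume w: "w \<in> f C"
    then have "{w} \<in> L" using L(2) fL[OF C] by blast
    with surj obtain D where D: "D \<in> K" "f D = {w}" by metis
    with K(1) obtain v where v: "v \<in> D" by (metis ex_in_conv)
    then have vK: "v \<in> \<Union>K" "{v} \<in> K" using D(1) K(2) by blast+
    have "f {v} \<subseteq> {w}" using le[OF vK(2) D(1)] v unfolding D(2) by blast
    then have "w = g v" unfolding g[OF vK(1)] by blast
    moreover have "f D \<subseteq> f C" using w unfolding D(2) by blast
    then have "v \<in> C" using le[OF D(1) C] v by blast
    ultimately show "w \<in> g ` C" by blast
  next
    fix w assume "w \<in> g ` C"
    then obtain v where v: "v \<in> C" "w = g v" by blast
    then have vK: "v \<in> \<Union>K" "{v} \<in> K" using C K(2) by blast+
    then have "f {v} \<subseteq> f C" using le[OF vK(2) C] v(1) by blast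
    then show "w \<in> f C" unfolding g[OF vK(1)] v(2) by blast
  qed
  have "inj_on g (\<Union>K)"
  proof (rule inj_onI)
    fix u v assume uv: "u \<in> \<Union>K" "v \<in> \<Union>K" "g u = g v"
    then have "f {u} = f {v}" by (simp add: g)
    then have "{u} \<subseteq> {v}" using le[OF K(2)[OF uv(1)] K(2)[OF uv(2)]] by blast
    then show "u = v" by blast
  qed
  moreover have im: "(image g) ` K = L"
    using bij img by (simp add: bij_betw_def cong: image_cong)
  moreover have "g ` \<Union>K = \<Union>L" using im by blast
  ultimately show ?thesis unfolding simplicial_iso_def bij_betw_def by blast
qed

section \<open>Vertex bijections between complexes of PIPs\<close>

lemma empty_notin_cubical_complex: "{} \<notin> cubical_complex P"
  by (auto simp: cubical_complex_def face_def)

lemma cubical_complex_vertex: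
  assumes "J \<in> \<Union> (cubical_complex P)"
  shows "{J} \<in> cubical_complex P"
proof -
  obtain I M N where "(I, M) \<in> cube_index P" "J = I - N" "N \<subseteq> M"
    using assms by (auto simp: cubical_complex_def face_def)
  then have "(J, {}) \<in> cube_index P" using cube_index_subface[of I M P N "{}"] by auto
  then show ?thesis using face_in_complex[of J "{}" P] by (simp add: face_def)
qed

lemma cubical_complex_iso_imp_simplicial_iso:
  assumes "complex_iso (cubical_complex P) (cubical_complex Q)"
  shows "simplicial_iso (cubical_complex P) (cubical_complex Q)"
  using assms empty_notin_cubical_complex cubical_complex_vertex
    empty_notin_cubical_complex cubical_complex_vertex
  by (rule complex_iso_imp_simplicial_iso)


section \<open>The crossing complex is an invariant of the cubical complex\<close>

lemma face_inj:
  assumes "M \<subseteq> I" "M' \<subseteq> I'" "face I M = face I' M'"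
  shows "I = I'" "M = M'"
proof -
  have "I \<subseteq> I' \<and> I' - M' \<subseteq> I - M" "I' \<subseteq> I \<and> I - M \<subseteq> I' - M'"
    using face_subset_iff[OF assms(1,2)] face_subset_iff[OF assms(2,1)] assms(3) by simp_all
  then show "I = I'" "M = M'" using assms by blast+
qed

text \<open>Makes the dimension of a cube visible in its vertex set, so that a vertex bijection
  preserving faces preserves dimension.\<close>

lemma card_face:
  assumes "M \<subseteq> I" "finite M"
  shows "card (face I M) = 2 ^ card M"
proof -
  have "face I M = (\<lambda>N. I - N) ` Pow M" by (auto simp: face_def)
  moreover have "inj_on (\<lambda>N. I - N) (Pow M)" using assms(1) by (auto intro!: inj_onI)
  ultimately show ?thesis using assms(2) by (simp add: card_image card_Pow)
qed

text \<open>The square has two edges of direction \<open>z\<close>, with top vertices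
  \<open>L\<close> and \<open>L - {w}\<close>. They partition its vertices, so the complement of one
  is the other; whether \<open>w\<close> lies in \<open>K\<close> decides which one is
  given.\<close>

lemma face_square_opposite:
  assumes "z \<in> L" "w \<in> L" "z \<noteq> w" "z \<in> K" "face K {z} \<subseteq> face L {z, w}"
  obtains N where "N \<subseteq> {w}" "face L {z, w} - face K {z} = face (L - N) {z}"
proof -
  have KL: "K \<subseteq> L" "L - {z, w} \<subseteq> K - {z}"
    using assms face_subset_iff[of "{z}" K "{z, w}" L] by auto
  have faces: "face K {z} = {J. K - {z} \<subseteq> J \<and> J \<subseteq> K}"
    "face L {z, w} = {J. L - {z, w} \<subseteq> J \<and> J \<subseteq> L}"
    using assms(1,2,4) by (simp_all add: face_eq)
  have face_N: "face (L - N) {z} = {J. L - N - {z} \<subseteq> J \<and> J \<subseteq> L - N}" if "N \<subseteq> {w}" for N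
    using assms(1,3) that by (intro face_eq) auto
  show ?thesis
  proof (cases "w \<in> K")
    case True
    with KL assms have "K = L" by blast
    have "face L {z, w} - face L {z} = face (L - {w}) {z}"
      unfolding faces[unfolded \<open>K = L\<close>] face_N[OF subset_refl]
    proof (rule set_eqI)
      fix J
      have "L - {z} \<subseteq> J \<longleftrightarrow> L - {z, w} \<subseteq> J \<and> w \<in> J" using assms(2,3) by auto
      moreover have "J \<subseteq> L - {w} \<longleftrightarrow> J \<subseteq> L \<and> w \<notin> J" "L - {w} - {z} = L - {z, w}" by auto
      ultimately show "J \<in> {J. L - {z, w} \<subseteq> J \<and> J \<subseteq> L} - {J. L - {z} \<subseteq> J \<and> J \<subseteq> L} \<longleftrightarrow>
          J \<in> {J. L - {w} - {z} \<subseteq> J \<and> J \<subseteq> L - {w}}" by auto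
    qed
    then show ?thesis using that[of "{w}"] \<open>K = L\<close> by simp
  next
    case False
    with KL assms have K: "K = L - {w}" by blast
    have "face L {z, w} - face (L - {w}) {z} = face (L - {}) {z}"
      unfolding faces[unfolded K] face_N[OF empty_subsetI]
    proof (rule set_eqI)
      fix J
      have "L - {z} \<subseteq> J \<longleftrightarrow> L - {z, w} \<subseteq> J \<and> w \<in> J" using assms(2,3) by auto
      moreover have "J \<subseteq> L - {w} \<longleftrightarrow> J \<subseteq> L \<and> w \<notin> J" "L - {w} - {z} = L - {z, w}" by auto
      ultimately show "J \<in> {J. L - {z, w} \<subseteq> J \<and> J \<subseteq> L} - {J. L - {w} - {z} \<subseteq> J \<and> J \<subseteq> L - {w}} \<longleftrightarrow>
          J \<in> {J. L - {} - {z} \<subseteq> J \<and> J \<subseteq> L - {}}" by auto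
    qed
    then show ?thesis using that[of "{}"] K by simp
  qed
qed

text \<open>The single label \<open>F x\<close> has to serve all edges of direction
  \<open>x\<close>. Edges are compared as vertex sets, so \<open>g\<close> may exchange the top and
  the bottom of an edge.\<close>

definition edge_labelling :: "'a pip \<Rightarrow> 'b pip \<Rightarrow> ('a set \<Rightarrow> 'b set) \<Rightarrow> ('a \<Rightarrow> 'b) \<Rightarrow> bool" where
  "edge_labelling P Q g F \<longleftrightarrow>
     (\<forall>I x. (I, {x}) \<in> cube_index P \<longrightarrow>
        (\<exists>J. (J, {F x}) \<in> cube_index Q \<and> g ` face I {x} = face J {F x}))"

lemma edge_labellingE:
  assumes "edge_labelling P Q g F" "(I, {x}) \<in> cube_index P"
  obtains J where "(J, {F x}) \<in> cube_index Q" "g ` face I {x} = face J {F x}"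
  using assms unfolding edge_labelling_def by blast

text \<open>Opposite edges of a square have the same label; they are recognized as disjoint edges whose
  union is a face, a property that only depends on the faces as vertex sets.\<close>

lemma edge_labelling_exists:
  fixes P :: "'a pip" and Q :: "'b pip"
  assumes P: "is_pip P" and Q: "is_pip Q"
    and inj: "inj_on g (\<Union> (cubical_complex P))"
    and im: "(image g) ` cubical_complex P = cubical_complex Q"
  shows "\<exists>F. edge_labelling P Q g F"
proof -
  have image_face: "\<exists>J N. (J, N) \<in> cube_index Q \<and> g ` face I M = face J N \<and> card N = card M"
    if IM: "(I, M) \<in> cube_index P" for I M
  proof -
    have "g ` face I M \<in> cubical_complex Q" using im face_in_complex[OF IM] by blast
    then obtain J N where JN: "(J, N) \<in> cube_index Q" "g ` face I M = face J N"
      by (auto simp: cubical_complex_def)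
    have fin: "finite M" "finite N"
      using finite_cube_directions P IM Q JN(1) by blast+
    have "inj_on g (face I M)" using inj face_in_complex[OF IM] by (blast intro: inj_on_subset)
    then have "card (face J N) = card (face I M)" using JN(2) by (metis card_image)
    then have "card N = card M"
      using fin cube_index_subset[OF IM] cube_index_subset[OF JN(1)] by (simp add: card_face)
    then show ?thesis using JN by blast
  qed
  have "\<exists>z. \<forall>I. (I, {x}) \<in> cube_index P \<longrightarrow>
          (\<exists>J. (J, {z}) \<in> cube_index Q \<and> g ` face I {x} = face J {z})" for x
  proof (cases "x \<in> elems P")
    case False
    \<comment> \<open>No edge has direction \<open>x\<close> here, so any label will do.\<close>
    then show ?thesis using cube_index_elems[of _ "{x}" P] cube_index_subset[of _ "{x}" P] by blast
  next
    case True
    \<comment> \<open>The label is read off the image of the reference edge; edges have two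
      vertices, so the image is again an edge. The induction then carries the label to every other
      edge of direction \<open>x\<close>.\<close>
    from image_face[OF cube_index_down_closure[OF P singleton_in_crossing_complex[OF P True]]]
    obtain J0 z where J0: "(J0, {z}) \<in> cube_index Q"
      "g ` face ((order P)\<inverse> `` {x}) {x} = face J0 {z}"
      by (auto simp: card_1_singleton_iff)
    have "\<exists>J. (J, {z}) \<in> cube_index Q \<and> g ` face I {x} = face J {z}"
      if "(I, {x}) \<in> cube_index P" for I
      using P that
    proof (induction rule: edge_induct)
      case base
      show ?case using J0 by blast
    next
      case (step I y)
      obtain K where K: "(K, {z}) \<in> cube_index Q" "g ` face (I - {y}) {x} = face K {z}"
        using step(3) by blast
      obtain L N where N: "(L, N) \<in> cube_index Q" "g ` face I {x, y} = face L N" "card N = 2"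
        using image_face[OF step(1)] step(2) by auto
      note sub = cube_index_subset[OF step(1)] cube_index_subset[OF K(1)]
        cube_index_subset[OF N(1)]
      have split: "face (I - {y}) {x} \<subseteq> face I {x, y}"
        "face I {x} = face I {x, y} - face (I - {y}) {x}"
        using sub(1) step(2) by (auto simp: face_eq)
      have KL: "face K {z} \<subseteq> face L N" using K(2) N(2) image_mono[OF split(1)] by metis
      with sub have "z \<in> N" using face_subset_iff[of "{z}" K N L] by auto
      with N(3) obtain w where w: "N = {z, w}" "z \<noteq> w"
        by (auto simp: card_2_iff)
      \<comment> \<open>By injectivity, the complement of an edge in the square goes to the
        complement of its image in the image square, which is the opposite edge and hence again of
        direction \<open>z\<close>.\<close>
      have "inj_on g (face I {x, y})"
        using inj face_in_complex[OF step(1)] by (blast intro: inj_on_subset)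
      then have "g ` face I {x} = face L {z, w} - face K {z}"
        using split K(2) N(2) w(1) by (metis inj_on_image_set_diff Diff_subset)
      moreover obtain N' where "N' \<subseteq> {w}" "face L {z, w} - face K {z} = face (L - N') {z}"
        using face_square_opposite[of z L w K] sub w KL by auto
      moreover have "(L - N', {z}) \<in> cube_index Q"
        using cube_index_subface[OF N(1), of N' "{z}"] w \<open>N' \<subseteq> {w}\<close> by auto
      ultimately show ?case by metis
    qed
    then show ?thesis by blast
  qed
  then show ?thesis unfolding edge_labelling_def by metis
qed

text \<open>Each direction of a cube is the direction of one of its edges, and the image of that
  edge lies in the image cube.\<close>

lemma edge_labelling_image_subset:
  assumes F: "edge_labelling P Q g F"
    and I: "(I, A) \<in> cube_index P" and J: "(J, B) \<in> cube_index Q"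
    and eq: "g ` face I A = face J B"
  shows "F ` A \<subseteq> B"
proof
  fix z assume "z \<in> F ` A"
  then obtain x where x: "x \<in> A" "z = F x" by blast
  have Ix: "(I, {x}) \<in> cube_index P" using cube_index_subface[OF I, of "{}" "{x}"] x by auto
  obtain K where K: "(K, {z}) \<in> cube_index Q" "g ` face I {x} = face K {z}"
    using edge_labellingE[OF F Ix] x by blast
  have "face I {x} \<subseteq> face I A" using x by (auto simp: face_def)
  then have "face K {z} \<subseteq> face J B" using K(2) eq by (metis image_mono)
  then show "z \<in> B"
    using face_subset_iff[of "{z}" K B J] cube_index_subset[OF K(1)] cube_index_subset[OF J] by auto
qed

text \<open>The reference edge of \<open>x\<close> returns to itself after both maps, and an edge
  determines its direction.\<close>

lemma edge_labelling_inverse: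
  assumes P: "is_pip P" and F: "edge_labelling P Q g F" and G: "edge_labelling Q P g' G"
    and inv: "\<And>C. C \<in> cubical_complex P \<Longrightarrow> g' ` g ` C = C"
    and x: "x \<in> elems P"
  shows "G (F x) = x" "F x \<in> elems Q"
proof -
  let ?I = "(order P)\<inverse> `` {x}"
  have I: "(?I, {x}) \<in> cube_index P"
    by (rule cube_index_down_closure[OF P singleton_in_crossing_complex[OF P x]])
  obtain J where J: "(J, {F x}) \<in> cube_index Q" "g ` face ?I {x} = face J {F x}"
    using edge_labellingE[OF F I] by blast
  obtain I' where I': "(I', {G (F x)}) \<in> cube_index P" "g' ` face J {F x} = face I' {G (F x)}"
    using edge_labellingE[OF G J(1)] by blast
  have eq: "face ?I {x} = face I' {G (F x)}" using J(2) I'(2) inv[OF face_in_complex[OF I]] by simp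
  then show "G (F x) = x"
    using face_inj(2)[OF cube_index_subset[OF I] cube_index_subset[OF I'(1)] eq] by simp
  show "F x \<in> elems Q" using cube_index_subset[OF J(1)] cube_index_elems[OF J(1)] by auto
qed

text \<open>Let \<open>B\<close> be the set of directions of the image of a cube with directions
  \<open>A\<close>. Then \<open>F\<close> maps \<open>A\<close> into \<open>B\<close> and
  \<open>G\<close> maps \<open>B\<close> into \<open>A\<close>; applying \<open>F\<close> to the
  latter turns the first inclusion into an equality.\<close>

lemma edge_labelling_crossing_complex:
  assumes P: "is_pip P" and Q: "is_pip Q"
    and F: "edge_labelling P Q g F" and G: "edge_labelling Q P g' G"
    and im: "(image g) ` cubical_complex P = cubical_complex Q"
    and inv: "\<And>C. C \<in> cubical_complex P \<Longrightarrow> g' ` g ` C = C"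
    and FG: "\<And>y. y \<in> elems Q \<Longrightarrow> F (G y) = y"
    and A: "A \<in> crossing_complex P"
  shows "F ` A \<in> crossing_complex Q"
proof -
  obtain I where I: "(I, A) \<in> cube_index P" using A unfolding crossing_complex_eq[OF P] by auto
  have "g ` face I A \<in> cubical_complex Q" using im face_in_complex[OF I] by blast
  then obtain J B where J: "(J, B) \<in> cube_index Q" "g ` face I A = face J B"
    by (auto simp: cubical_complex_def)
  have "g' ` face J B = face I A" using J(2) inv[OF face_in_complex[OF I]] by simp
  then have "G ` B \<subseteq> A" by (rule edge_labelling_image_subset[OF G J(1) I])
  moreover have "F ` G ` B = B"
    using FG cube_index_subset[OF J(1)] cube_index_elems[OF J(1)]
    by (simp add: image_image subset_iff cong: image_cong)
  ultimately have "B \<subseteq> F ` A" by (metis image_mono)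
  then have "F ` A = B" using edge_labelling_image_subset[OF F I J] by simp
  then show ?thesis using J(1) unfolding crossing_complex_eq[OF Q] by (simp add: rev_image_eqI)
qed

theorem crossing_complex_invariant:
  fixes P :: "'a pip" and Q :: "'b pip"
  assumes P: "is_pip P" and Q: "is_pip Q"
    and iso: "complex_iso (cubical_complex P) (cubical_complex Q)"
  shows "simplicial_iso (crossing_complex P) (crossing_complex Q)"
proof -
  obtain g where bij: "bij_betw g (\<Union> (cubical_complex P)) (\<Union> (cubical_complex Q))"
    and im: "(image g) ` cubical_complex P = cubical_complex Q"
    using cubical_complex_iso_imp_simplicial_iso[OF iso] unfolding simplicial_iso_def by metis
  define g' where "g' = inv_into (\<Union> (cubical_complex P)) g"
  have inj: "inj_on g (\<Union> (cubical_complex P))" using bij by (rule bij_betw_imp_inj_on)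
  have inv: "g' ` g ` C = C" if "C \<in> cubical_complex P" for C
    unfolding g'_def using inj Union_upper[OF that] by (rule inv_into_image_cancel)
  have inv': "g ` g' ` D = D" if "D \<in> cubical_complex Q" for D
  proof -
    have "D \<in> (image g) ` cubical_complex P" unfolding im by (rule that)
    then obtain C where C: "D = g ` C" "C \<in> cubical_complex P" by (rule imageE)
    show ?thesis unfolding C(1) inv[OF C(2)] by (rule refl)
  qed
  have im': "(image g') ` cubical_complex Q = cubical_complex P"
  proof -
    have "(image g') ` (image g) ` cubical_complex P = (\<lambda>C. C) ` cubical_complex P"
      unfolding image_image[of "image g'"] by (rule image_cong[OF refl inv])
    then show ?thesis unfolding im by simp
  qed
  have inj': "inj_on g' (\<Union> (cubical_complex Q))"
    unfolding g'_def using bij_betw_inv_into[OF bij] by (rule bij_betw_imp_inj_on)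
  obtain F where F: "edge_labelling P Q g F" using edge_labelling_exists[OF P Q inj im] by blast
  obtain G where G: "edge_labelling Q P g' G" using edge_labelling_exists[OF Q P inj' im'] by blast
  note GF = edge_labelling_inverse[OF P F G inv] and FG = edge_labelling_inverse[OF Q G F inv']
  have "bij_betw F (elems P) (elems Q)"
    by (rule bij_betw_byWitness[where f' = G]) (simp_all add: GF FG image_subset_iff)
  moreover have "(image F) ` crossing_complex P = crossing_complex Q"
  proof (intro equalityI subsetI)
    fix B assume "B \<in> (image F) ` crossing_complex P"
    then show "B \<in> crossing_complex Q"
      using edge_labelling_crossing_complex[OF P Q F G im inv FG(1)] by blast
  next
    fix B assume B: "B \<in> crossing_complex Q"
    then have "B \<subseteq> elems Q" by (auto simp: crossing_complex_def consistent_def)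
    then have "B = F ` G ` B" using FG(1) by (simp add: image_image subset_iff cong: image_cong)
    moreover have "G ` B \<in> crossing_complex P"
      using edge_labelling_crossing_complex[OF Q P G F im' inv' GF(1) B] by blast
    ultimately show "B \<in> (image F) ` crossing_complex P" by blast
  qed
  ultimately show ?thesis
    unfolding simplicial_iso_def using Union_crossing_complex P Q by metis
qed


section \<open>The crossing complex of a hyperplane\<close>

text \<open>Provides the PIP over \<open>nat\<close> demanded by the existence half of
  \<open>is_crossing_complex_of\<close>, by transporting the structure along an injection.\<close>

lemma pip_relabel:
  fixes P :: "'a pip"
  assumes P: "is_pip P"
  obtains Q :: "nat pip" where "is_pip Q" "complex_iso (cubical_complex P) (cubical_complex Q)"
proof -
  have "finite (elems P)" using P by (simp add: is_pip_def)
  then obtain h :: "'a \<Rightarrow> nat" where h: "inj_on h (elems P)"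
    using finite_imp_inj_to_nat_seg by metis
  define Q :: "nat pip" where "Q = \<lparr>elems = h ` elems P,
    order = map_prod h h ` order P, incons = map_prod h h ` incons P\<rparr>"
  have elems: "elems Q = h ` elems P" by (simp add: Q_def)
  have rel: "order P \<subseteq> elems P \<times> elems P" "incons P \<subseteq> elems P \<times> elems P"
    using pip_order(4)[OF P] pip_incons(4)[OF P] by auto
  have "inj_on (map_prod h h) (elems P \<times> elems P)" using h h by (rule map_prod_inj_on)
  then have mem: "map_prod h h (a, b) \<in> map_prod h h ` R \<longleftrightarrow> (a, b) \<in> R"
    if "a \<in> elems P" "b \<in> elems P" "R \<subseteq> elems P \<times> elems P" for a b R
    by (rule inj_on_image_mem_iff) (use that in auto)
  have order: "(h a, h b) \<in> order Q \<longleftrightarrow> (a, b) \<in> order P"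
    if "a \<in> elems P" "b \<in> elems P" for a b
    using mem[OF that rel(1)] by (simp add: Q_def)
  have incons: "(h a, h b) \<in> incons Q \<longleftrightarrow> (a, b) \<in> incons P"
    if "a \<in> elems P" "b \<in> elems P" for a b
    using mem[OF that rel(2)] by (simp add: Q_def)
  have order_sub: "order Q \<subseteq> elems Q \<times> elems Q" and incons_sub: "incons Q \<subseteq> elems Q \<times> elems Q"
    using rel by (auto simp: Q_def)
  have "is_pip Q"
  proof -
    have "refl_on (elems Q) (order Q)"
      using pip_order(1)[OF P] order by (auto simp: refl_on_def elems)
    moreover have "trans (order Q)"
    proof (rule transI)
      fix a b c assume abc: "(a, b) \<in> order Q" "(b, c) \<in> order Q"
      then have "a \<in> h ` elems P" "b \<in> h ` elems P" "c \<in> h ` elems P"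
        using order_sub by (auto simp: elems)
      then obtain a' b' c' where "a' \<in> elems P" "b' \<in> elems P" "c' \<in> elems P"
        "a = h a'" "b = h b'" "c = h c'" by (elim imageE)
      then show "(a, c) \<in> order Q" using abc order pip_order(2)[OF P, of a' b' c'] by simp
    qed
    moreover have "antisym (order Q)"
    proof (rule antisymI)
      fix a b assume ab: "(a, b) \<in> order Q" "(b, a) \<in> order Q"
      then have "a \<in> h ` elems P" "b \<in> h ` elems P" using order_sub by (auto simp: elems)
      then obtain a' b' where "a' \<in> elems P" "b' \<in> elems P" "a = h a'" "b = h b'"
        by (elim imageE)
      then show "a = b" using ab order pip_order(3)[OF P, of a' b'] by simp
    qed
    moreover have "irrefl (incons Q)"
      using incons incons_sub pip_incons(1)[OF P] by (fastforce simp: irrefl_def elems)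
    moreover have "sym (incons Q)"
      using pip_incons(2)[OF P] by (auto simp: Q_def intro!: symI)
    moreover have "(a', b') \<in> incons Q"
      if "(a, b) \<in> incons Q" "(a, a') \<in> order Q" "(b, b') \<in> order Q" for a a' b b'
    proof -
      have "a \<in> h ` elems P" "a' \<in> h ` elems P" "b \<in> h ` elems P" "b' \<in> h ` elems P"
        using that(2,3) order_sub by (auto simp: elems)
      then obtain c c' d d' where c: "c \<in> elems P" "c' \<in> elems P" "d \<in> elems P" "d' \<in> elems P"
        "a = h c" "a' = h c'" "b = h d" "b' = h d'" by (elim imageE)
      then have "(c, d) \<in> incons P" "(c, c') \<in> order P" "(d, d') \<in> order P"
        using that order incons by simp_all
      then show ?thesis using pip_incons(3)[OF P, of c d c' d'] c incons by simp
    qed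
    ultimately show ?thesis
      using order_sub incons_sub \<open>finite (elems P)\<close>
      by (auto simp: is_pip_def partial_order_on_def preorder_on_def elems)
  qed
  moreover have "complex_iso (cubical_complex P) (cubical_complex Q)"
  proof -
    have down: "downset Q (h ` I) \<longleftrightarrow> downset P I" if I: "I \<subseteq> elems P" for I
    proof
      assume d: "downset Q (h ` I)"
      have "a \<in> I" if ab: "b \<in> I" "(a, b) \<in> order P" for a b
      proof -
        have E: "a \<in> elems P" "b \<in> elems P" using pip_order(4)[OF P ab(2)] by auto
        then have "(h a, h b) \<in> order Q" using ab(2) order by simp
        then have "h a \<in> h ` I" using d ab(1) unfolding downset_def by blast
        then show "a \<in> I" using \<open>a \<in> elems P\<close> I h by (simp add: inj_on_image_mem_iff)
      qed
      then show "downset P I" using I by (auto simp: downset_def)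
    next
      assume d: "downset P I"
      have "a \<in> h ` I" if ab: "b \<in> I" "(a, h b) \<in> order Q" for a b
      proof -
        have "a \<in> h ` elems P" using ab(2) order_sub by (auto simp: elems)
        then obtain a' where a': "a' \<in> elems P" "a = h a'" by blast
        then have "(a', b) \<in> order P" using ab order I by auto
        then show ?thesis using ab(1) a'(2) d unfolding downset_def by blast
      qed
      then show "downset Q (h ` I)" using I by (auto simp: downset_def elems)
    qed
    have cons: "consistent Q (h ` I) \<longleftrightarrow> consistent P I" if "I \<subseteq> elems P" for I
      using that incons by (auto simp: consistent_def elems subset_iff)
    have max: "maximals Q (h ` I) = h ` maximals P I" if "I \<subseteq> elems P" for I
    proof -
      have "h y = h m \<longleftrightarrow> y = m" if "m \<in> I" "y \<in> I" for m y
        using h \<open>I \<subseteq> elems P\<close> that by (meson inj_on_eq_iff subsetD)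
      moreover have "(h m, h y) \<in> order Q \<longleftrightarrow> (m, y) \<in> order P" if "m \<in> I" "y \<in> I" for m y
        using order \<open>I \<subseteq> elems P\<close> that by blast
      ultimately show ?thesis by (auto simp: maximals_def)
    qed
    have index: "cube_index Q = (\<lambda>(I, M). (h ` I, h ` M)) ` cube_index P"
    proof (intro equalityI subsetI)
      fix c assume "c \<in> cube_index Q"
      then obtain J N where c: "c = (J, N)" "downset Q J" "consistent Q J" "N \<subseteq> maximals Q J"
        by (auto simp: cube_index_def)
      then obtain I where I: "I \<subseteq> elems P" "J = h ` I"
        by (auto simp: downset_def elems subset_image_iff)
      then obtain M where M: "M \<subseteq> maximals P I" "N = h ` M"
        using c(4) max by (auto simp: subset_image_iff)
      then have "(I, M) \<in> cube_index P" using I c down cons by (simp add: cube_index_def)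
      then show "c \<in> (\<lambda>(I, M). (h ` I, h ` M)) ` cube_index P" using c I M by force
    next
      fix c assume "c \<in> (\<lambda>(I, M). (h ` I, h ` M)) ` cube_index P"
      then obtain I M where IM: "c = (h ` I, h ` M)" "(I, M) \<in> cube_index P" by auto
      then show "c \<in> cube_index Q"
        using cube_index_elems[OF IM(2)] down cons max by (auto simp: cube_index_def)
    qed
    let ?\<psi> = "\<lambda>(I, M). face (h ` I) (h ` M)"
    have "complex_iso ((\<lambda>(I, M). face I M) ` cube_index P) (?\<psi> ` cube_index P)"
    proof (rule complex_isoI, clarify)
      fix I M I' M' assume c: "(I, M) \<in> cube_index P" "(I', M') \<in> cube_index P"
      note s = cube_index_subset[OF c(1)] cube_index_subset[OF c(2)]
        cube_index_elems[OF c(1)] cube_index_elems[OF c(2)]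
      have d: "h ` I - h ` M = h ` (I - M)" "h ` I' - h ` M' = h ` (I' - M')"
        using s by (intro inj_on_image_set_diff[OF h, symmetric]; blast)+
      have m: "h ` A \<subseteq> h ` B \<longleftrightarrow> A \<subseteq> B" if "A \<subseteq> elems P" "B \<subseteq> elems P" for A B
      proof
        assume "h ` A \<subseteq> h ` B"
        then show "A \<subseteq> B" using inj_on_image_mem_iff[OF h _ that(2)] that(1) by blast
      qed (rule image_mono)
      show "face I M \<subseteq> face I' M' \<longleftrightarrow> face (h ` I) (h ` M) \<subseteq> face (h ` I') (h ` M')"
        unfolding face_subset_iff[OF s(1,2)] face_subset_iff[OF image_mono[OF s(1)] image_mono[OF s(2)]] d
          m[OF s(3,4)] m[OF subset_trans[OF Diff_subset s(4)] subset_trans[OF Diff_subset s(3)]]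
        by (rule refl)
    qed
    moreover have "?\<psi> ` cube_index P = cubical_complex Q"
      unfolding cubical_complex_eq index by (simp add: image_image case_prod_unfold)
    ultimately show ?thesis unfolding cubical_complex_eq[of P] by simp
  qed
  ultimately show ?thesis using that by blast
qed

section \<open>Cubes with direction \<open>x\<close> and the cubes of
  \<open>P\<^sub>x\<close>\<close>

lemma crossing_elems_subset: "crossing_elems P x \<subseteq> elems P"
  by (auto simp: crossing_elems_def)

text \<open>Since \<open>x\<close> is maximal in the consistent set \<open>I\<close>, every element
  of \<open>I\<close> not below \<open>x\<close> is consistent and incomparable with
  \<open>x\<close>. The other directions are maximal too, hence not below \<open>x\<close>.\<close>

lemma hyperplane_cube:
  assumes P: "is_pip P" and IM: "(I, M) \<in> cube_index P" and xM: "x \<in> M"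
  shows "I = I \<inter> crossing_elems P x \<union> (order P)\<inverse> `` {x}"
    and "M - {x} \<subseteq> crossing_elems P x"
proof -
  let ?D = "(order P)\<inverse> `` {x}"
  have I: "I \<subseteq> elems P" "\<And>a b. b \<in> I \<Longrightarrow> (a, b) \<in> order P \<Longrightarrow> a \<in> I"
    "\<And>a b. a \<in> I \<Longrightarrow> b \<in> I \<Longrightarrow> (a, b) \<notin> incons P" "x \<in> I" "M \<subseteq> I"
    "\<And>m y. m \<in> M \<Longrightarrow> y \<in> I \<Longrightarrow> (m, y) \<in> order P \<Longrightarrow> y = m"
    using IM xM by (auto simp: cube_index_def downset_def consistent_def maximals_def)
  have S: "y \<in> crossing_elems P x" if "y \<in> I" "(y, x) \<notin> order P" for y
  proof -
    have "y \<in> elems P" using that(1) I(1) by blast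
    moreover have "(x, y) \<notin> order P"
    proof
      assume "(x, y) \<in> order P"
      then have "y = x" by (rule I(6)[OF xM that(1)])
      with \<open>(x, y) \<in> order P\<close> that(2) show False by simp
    qed
    ultimately show ?thesis
      using that(2) I(3)[OF I(4) that(1)] by (simp add: crossing_elems_def)
  qed
  have "?D \<subseteq> I" using I(2)[OF I(4)] by auto
  moreover have "I \<subseteq> I \<inter> crossing_elems P x \<union> ?D" using S by auto
  ultimately show "I = I \<inter> crossing_elems P x \<union> ?D" by auto
  show "M - {x} \<subseteq> crossing_elems P x"
  proof
    fix y assume y: "y \<in> M - {x}"
    then have "(y, x) \<notin> order P" using I(6)[of y x] I(4) by auto
    with y show "y \<in> crossing_elems P x" using S I(5) by auto
  qed
qed

text \<open>The work is in surjectivity: a cube \<open>(J, N)\<close> of \<open>P\<^sub>x\<close>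
  comes from the cube whose top vertex is \<open>J\<close> together with the principal downset of
  \<open>x\<close> and whose directions are \<open>insert x N\<close>.\<close>

lemma cube_index_crossing_elems:
  assumes P: "is_pip P" and x: "x \<in> elems P"
  shows "cube_index (sub_pip P (crossing_elems P x)) =
    (\<lambda>(I, M). (I \<inter> crossing_elems P x, M - {x})) ` {(I, M) \<in> cube_index P. x \<in> M}"
proof -
  define S where "S = crossing_elems P x"
  let ?D = "(order P)\<inverse> `` {x}"
  have SE: "S \<subseteq> elems P" by (simp add: S_def crossing_elems_subset)
  have S: "(x, s) \<notin> incons P" "(s, x) \<notin> incons P" "(x, s) \<notin> order P" "(s, x) \<notin> order P"
    if "s \<in> S" for s
    using that pip_incons(2)[OF P, of s x] by (auto simp: S_def crossing_elems_def)
  have "cube_index (sub_pip P S) = (\<lambda>(I, M). (I \<inter> S, M - {x})) ` {(I, M) \<in> cube_index P. x \<in> M}"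
  proof (intro equalityI subsetI)
    fix c assume "c \<in> cube_index (sub_pip P S)"
    moreover obtain J N where c: "c = (J, N)" by (cases c)
    ultimately have index: "downset (sub_pip P S) J" "consistent (sub_pip P S) J"
      and max: "N \<subseteq> maximals (sub_pip P S) J"
      by (simp_all add: cube_index_def)
    have J: "J \<subseteq> S" "N \<subseteq> J"
      using index(1) subset_trans[OF max] by (simp_all add: downset_def maximals_def sub_pip_def)
    have "downset (sub_pip P S) J \<longleftrightarrow>
        J \<subseteq> S \<and> (\<forall>b\<in>J. \<forall>a. (a, b) \<in> order P \<inter> S \<times> S \<longrightarrow> a \<in> J)"
      by (simp add: sub_pip_def downset_def)
    with index(1) have down: "\<forall>b\<in>J. \<forall>a. (a, b) \<in> order P \<inter> S \<times> S \<longrightarrow> a \<in> J"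
      by iprover
    have "consistent (sub_pip P S) J \<longleftrightarrow>
        J \<subseteq> S \<and> (\<forall>a\<in>J. \<forall>b\<in>J. (a, b) \<notin> incons P \<inter> S \<times> S)"
      by (simp add: sub_pip_def consistent_def)
    with index(2) have cons: "\<forall>a\<in>J. \<forall>b\<in>J. (a, b) \<notin> incons P \<inter> S \<times> S"
      by iprover
    have J_down: "a \<in> J" if "b \<in> J" "a \<in> S" "(a, b) \<in> order P" for a b
      using down[rule_format, OF that(1), of a] that subsetD[OF J(1) that(1)] by simp
    have J_cons: "(a, b) \<notin> incons P" if "a \<in> J" "b \<in> J" for a b
      using cons[rule_format, OF that] that[THEN subsetD[OF J(1)]] by simp
    have J_max: "y = m" if "m \<in> N" "y \<in> J" "(m, y) \<in> order P" for m y
    proof -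
      have "m \<in> maximals (sub_pip P S) J" using max that(1) by (rule subsetD)
      moreover have "m \<in> S" "y \<in> S"
        using subsetD[OF J(2) that(1)] that(2) by (simp_all add: subsetD[OF J(1)])
      ultimately show ?thesis using that(2,3) by (simp add: maximals_def sub_pip_def)
    qed
    have D: "y \<in> ?D \<longleftrightarrow> (y, x) \<in> order P" for y by auto
    have xD: "x \<in> ?D" using pip_order(1)[OF P x] by simp
    have DS: "?D \<inter> S = {}" using S(4) by auto
    have DE: "?D \<subseteq> elems P" using pip_order(4)[OF P] by auto
    \<comment> \<open>If \<open>a\<close> is below \<open>b\<close> and were above \<open>x\<close>
      or inconsistent with \<open>x\<close>, then so would be \<open>b\<close>, which lies in
      \<open>P\<^sub>x\<close>. Hence \<open>a\<close> is below \<open>x\<close> or in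
      \<open>P\<^sub>x\<close>, where \<open>J\<close> is closed downwards.\<close>
    have below: "a \<in> J \<union> ?D" if ab: "b \<in> J" "(a, b) \<in> order P" for a b
    proof (cases "(a, x) \<in> order P")
      case False
      have b: "b \<in> S" using ab J(1) by blast
      have "a \<in> elems P" "b \<in> elems P" using pip_order(4)[OF P ab(2)] by auto
      moreover have "(x, a) \<notin> incons P"
        using pip_incons(3)[OF P, of x a x b] pip_order(1)[OF P x] ab(2) S(1)[OF b] by blast
      moreover have "(x, a) \<notin> order P"
        using pip_order(2)[OF P, of x a b] ab(2) S(3)[OF b] by blast
      ultimately have "a \<in> S" using False by (simp add: S_def crossing_elems_def)
      then show ?thesis using J_down ab by blast
    qed simp
    \<comment> \<open>An inconsistency involving the principal downset moves up to \<open>x\<close>: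
      here it would make \<open>x\<close> inconsistent with an element of \<open>P\<^sub>x\<close>,
      in the next claim with itself.\<close>
    have incDJ: "(a, b) \<notin> incons P" if "a \<in> ?D" "b \<in> J" for a b
      using that pip_incons(3)[OF P, of a b x b] pip_order(1)[OF P, of b] S(1)[of b] J(1) SE
      by (auto simp: D)
    have incDD: "(a, b) \<notin> incons P" if "a \<in> ?D" "b \<in> ?D" for a b
      using that pip_incons(3)[OF P, of a b x x] pip_incons(1)[OF P] by (auto simp: D)
    have "downset P (J \<union> ?D)"
      unfolding downset_def
    proof (intro conjI ballI allI impI)
      show "J \<union> ?D \<subseteq> elems P" using J(1) SE DE by blast
      fix a b assume "b \<in> J \<union> ?D" "(a, b) \<in> order P"
      then show "a \<in> J \<union> ?D" using below pip_order(2)[OF P, of a b x] by (auto simp: D)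
    qed
    moreover have "consistent P (J \<union> ?D)"
      unfolding consistent_def
    proof (intro conjI ballI)
      show "J \<union> ?D \<subseteq> elems P" using J(1) SE DE by blast
      fix a b assume "a \<in> J \<union> ?D" "b \<in> J \<union> ?D"
      then show "(a, b) \<notin> incons P"
        using J_cons incDJ incDD pip_incons(2)[OF P, of a b] by blast
    qed
    \<comment> \<open>No element of \<open>J\<close> is comparable with \<open>x\<close>, so neither
      \<open>x\<close> lies below a member of \<open>J\<close> nor an element of \<open>N\<close>
      below a member of the principal downset.\<close>
    moreover have "insert x N \<subseteq> maximals P (J \<union> ?D)"
    proof
      fix m assume m: "m \<in> insert x N"
      have "y = m" if y: "y \<in> J \<union> ?D" "(m, y) \<in> order P" for y
      proof (cases "m = x")
        case True
        then show ?thesis using y S(3)[of y] J(1) pip_order(3)[OF P, of x y] by (auto simp: D)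
      next
        case False
        then have "m \<in> N" "m \<in> S" using m J by auto
        then show ?thesis
          using y J_max[of m y] pip_order(2)[OF P, of m y x] S(4)[of m] by (auto simp: D)
      qed
      then show "m \<in> maximals P (J \<union> ?D)" using m xD J(2) unfolding maximals_def by blast
    qed
    ultimately have ci: "(J \<union> ?D, insert x N) \<in> cube_index P" by (simp add: cube_index_def)
    have "x \<notin> S" using DS xD by blast
    then have eqs: "(J \<union> ?D) \<inter> S = J" "insert x N - {x} = N" using J DS by blast+
    show "c \<in> (\<lambda>(I, M). (I \<inter> S, M - {x})) ` {(I, M) \<in> cube_index P. x \<in> M}"
      by (rule image_eqI[of _ _ "(J \<union> ?D, insert x N)"]) (simp_all add: c eqs ci)
  next
    fix c assume "c \<in> (\<lambda>(I, M). (I \<inter> S, M - {x})) ` {(I, M) \<in> cube_index P. x \<in> M}"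
    then obtain I M where c: "c = (I \<inter> S, M - {x})" and IM: "(I, M) \<in> cube_index P" "x \<in> M" by auto
    have "downset P I" "consistent P I" "M \<subseteq> maximals P I"
      using IM(1) by (simp_all add: cube_index_def)
    then have "downset (sub_pip P S) (I \<inter> S)" "consistent (sub_pip P S) (I \<inter> S)"
      "maximals P I \<inter> S \<subseteq> maximals (sub_pip P S) (I \<inter> S)"
      unfolding downset_def consistent_def maximals_def sub_pip_def pip.select_convs by blast+
    moreover have "M - {x} \<subseteq> maximals P I \<inter> S"
      using hyperplane_cube(2)[OF P IM, folded S_def] \<open>M \<subseteq> maximals P I\<close> by blast
    ultimately show "c \<in> cube_index (sub_pip P S)"
      unfolding c cube_index_def by blast
  qed
  then show ?thesis unfolding S_def .
qed

text \<open>Both complexes are indexed by the cubes with direction \<open>x\<close>. Their top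
  vertices all contain the same principal downset, disjoint from \<open>P\<^sub>x\<close>, so
  cutting it off changes no inclusion.\<close>

lemma hyperplane_iso:
  assumes P: "is_pip P" and x: "x \<in> elems P"
  shows "complex_iso (hyperplane P x) (cubical_complex (sub_pip P (crossing_elems P x)))"
proof -
  define S where "S = crossing_elems P x"
  let ?X = "{(I, M) \<in> cube_index P. x \<in> M}" and ?D = "(order P)\<inverse> `` {x}"
  let ?\<psi> = "\<lambda>(I, M). face (I \<inter> S) (M - {x})"
  note index = cube_index_crossing_elems[OF P x, folded S_def] and
    cube = hyperplane_cube[OF P, of _ _ x, folded S_def]
  have DS: "?D \<inter> S = {}" "x \<notin> S" using pip_order(1)[OF P x] by (auto simp: S_def crossing_elems_def)
  \<comment> \<open>Bottom vertices split in the same way: directions other than \<open>x\<close>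
    lie in \<open>S\<close>, so the principal downset loses only \<open>x\<close>.\<close>
  have diff: "A \<inter> S \<union> ?D - N = (A \<inter> S - (N - {x})) \<union> (?D - {x})"
    if "N - {x} \<subseteq> S" "x \<in> N" for A N
    using that DS by blast
  have "complex_iso ((\<lambda>(I, M). midplane I M x) ` ?X) (?\<psi> ` ?X)"
  proof (rule complex_isoI, clarify)
    fix I M I' M'
    assume c: "(I, M) \<in> cube_index P" "x \<in> M" "(I', M') \<in> cube_index P" "x \<in> M'"
    note s = cube_index_subset[OF c(1)] cube_index_subset[OF c(3)]
      cube(1)[OF c(1,2)] cube(1)[OF c(3,4)] cube(2)[OF c(1,2)] cube(2)[OF c(3,4)]
    have "I \<subseteq> I' \<longleftrightarrow> I \<inter> S \<subseteq> I' \<inter> S"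
    proof
      assume "I \<inter> S \<subseteq> I' \<inter> S"
      then have "I \<inter> S \<union> ?D \<subseteq> I' \<inter> S \<union> ?D" by (rule Un_mono[OF _ subset_refl])
      then show "I \<subseteq> I'" unfolding s(3)[symmetric] s(4)[symmetric] .
    qed auto
    moreover have "I' - M' \<subseteq> I - M \<longleftrightarrow> I' \<inter> S - (M' - {x}) \<subseteq> I \<inter> S - (M - {x})"
    proof -
      have "I - M = (I \<inter> S - (M - {x})) \<union> (?D - {x})"
        using diff[OF s(5) c(2), of I] unfolding s(3)[symmetric] .
      moreover have "I' - M' = (I' \<inter> S - (M' - {x})) \<union> (?D - {x})"
        using diff[OF s(6) c(4), of I'] unfolding s(4)[symmetric] .
      moreover have "A \<inter> S - M' \<union> (?D - {x}) \<subseteq> B \<inter> S - M \<union> (?D - {x}) \<longleftrightarrow>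
          A \<inter> S - M' \<subseteq> B \<inter> S - M" for A B M M'
        using DS(1) by blast
      ultimately show ?thesis by (simp only:)
    qed
    ultimately have "I \<subseteq> I' \<and> I' - M' \<subseteq> I - M \<longleftrightarrow>
        I \<inter> S \<subseteq> I' \<inter> S \<and> I' \<inter> S - (M' - {x}) \<subseteq> I \<inter> S - (M - {x})"
      by (simp only:)
    moreover have "M - {x} \<subseteq> I \<inter> S" "M' - {x} \<subseteq> I' \<inter> S" using s(1,2,5,6) by blast+
    ultimately show "midplane I M x \<subseteq> midplane I' M' x \<longleftrightarrow>
        face (I \<inter> S) (M - {x}) \<subseteq> face (I' \<inter> S) (M' - {x})"
      using midplane_subset_iff[OF s(1,2) c(2,4)] by (simp only: face_subset_iff)
  qed
  moreover have "(\<lambda>(I, M). midplane I M x) ` ?X = hyperplane P x"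
    by (auto simp: hyperplane_def)
  moreover have "?\<psi> ` ?X = cubical_complex (sub_pip P S)"
    unfolding cubical_complex_eq index image_image by (simp add: case_prod_unfold)
  ultimately show ?thesis by (simp add: S_def)
qed

text \<open>The pairs that \<open>x\<close> forms with the elements of \<open>A\<close> impose
  exactly the conditions defining \<open>crossing_elems P x\<close>; reflexivity of the order keeps
  \<open>x\<close> itself out of that set.\<close>

lemma crossing_complex_crossing_elems:
  assumes P: "is_pip P" and x: "x \<in> elems P"
  shows "crossing_complex (sub_pip P (crossing_elems P x)) = link (crossing_complex P) {x}"
proof -
  have sub: "A \<in> crossing_complex (sub_pip P (crossing_elems P x)) \<longleftrightarrow>
      A \<subseteq> crossing_elems P x \<and> consistent P A \<and> antichain P A" for A
  proof (cases "A \<subseteq> crossing_elems P x")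
    case True
    have "A \<subseteq> elems P" using True crossing_elems_subset by (rule subset_trans)
    then show ?thesis
      by (simp add: crossing_complex_def consistent_def antichain_def sub_pip_def True
          subsetD[OF True] cong: ball_cong)
  qed (simp add: crossing_complex_def consistent_def sub_pip_def)
  have cons: "consistent P (insert x A) \<longleftrightarrow> consistent P A \<and> (\<forall>a\<in>A. (x, a) \<notin> incons P)" for A
    using x pip_incons(1,2)[OF P] unfolding consistent_def by blast
  have anti: "antichain P (insert x A) \<longleftrightarrow>
      antichain P A \<and> (\<forall>a\<in>A. (x, a) \<notin> order P \<and> (a, x) \<notin> order P)" if "x \<notin> A" for A
    using x that unfolding antichain_def by blast
  have elems: "A \<subseteq> crossing_elems P x \<longleftrightarrow> A \<subseteq> elems P \<and> (\<forall>a\<in>A. (x, a) \<notin> incons P) \<and>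
      (\<forall>a\<in>A. (x, a) \<notin> order P \<and> (a, x) \<notin> order P)" for A
    unfolding crossing_elems_def by blast
  have link: "A \<in> link (crossing_complex P) {x} \<longleftrightarrow>
      x \<notin> A \<and> consistent P A \<and> antichain P A \<and> consistent P (insert x A) \<and> antichain P (insert x A)"
    for A
    unfolding link_def crossing_complex_def by auto
  have "x \<notin> crossing_elems P x"
    using pip_order(1)[OF P x] by (simp add: crossing_elems_def)
  then have "x \<notin> A" if "A \<subseteq> crossing_elems P x" for A using that by blast
  moreover have "consistent P A \<Longrightarrow> A \<subseteq> elems P" for A by (simp add: consistent_def)
  ultimately have "A \<subseteq> crossing_elems P x \<and> consistent P A \<and> antichain P A \<longleftrightarrow>
      x \<notin> A \<and> consistent P A \<and> antichain P A \<and> consistent P (insert x A) \<and> antichain P (insert x A)"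
    for A
    using elems[of A] anti[of A] cons[of A] by blast
  then show ?thesis unfolding set_eq_iff sub link by blast
qed

theorem corollary5p6:
  fixes P :: "'a pip" and x :: 'a
  assumes "is_pip P" and "x \<in> elems P"
  shows "hyperplane P x \<in> hyperplanes P \<and>
         is_crossing_complex_of (crossing_complex (sub_pip P (crossing_elems P x)))
           (hyperplane P x) \<and>
         crossing_complex (sub_pip P (crossing_elems P x)) = link (crossing_complex P) {x}"
proof (intro conjI)
  let ?Px = "sub_pip P (crossing_elems P x)"
  have pip: "is_pip ?Px" using assms(1) crossing_elems_subset by (rule is_pip_sub_pip)
  note iso = hyperplane_iso[OF assms]
  show "hyperplane P x \<in> hyperplanes P" using assms by (rule hyperplane_in_hyperplanes)
  show "is_crossing_complex_of (crossing_complex ?Px) (hyperplane P x)"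
    unfolding is_crossing_complex_of_def
  proof (intro conjI allI impI)
    show "\<exists>Q :: nat pip. is_pip Q \<and> complex_iso (hyperplane P x) (cubical_complex Q)"
      using pip_relabel[OF pip] complex_iso_trans[OF iso] by metis
    fix Q :: "nat pip"
    assume Q: "is_pip Q" "complex_iso (hyperplane P x) (cubical_complex Q)"
    \<comment> \<open>Through the hyperplane, the complex of any such \<open>Q\<close> is isomorphic
      to that of \<open>P\<^sub>x\<close>, so the invariance of the crossing complex
      applies.\<close>
    have "complex_iso (cubical_complex Q) (cubical_complex ?Px)"
      using complex_iso_trans[OF complex_iso_sym[OF Q(2)] iso] .
    then show "simplicial_iso (crossing_complex Q) (crossing_complex ?Px)"
      by (rule crossing_complex_invariant[OF Q(1) pip])
  qed
  show "crossing_complex ?Px = link (crossing_complex P) {x}"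
    using assms by (rule crossing_complex_crossing_elems)
qed

end
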